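(* Let $X\neq\{0\}$ be a Banach space and let $p,q\in\mathcal{N}(X)$ belong to the same intrinsic part of $\mathcal{N}(X)$. Then the intrinsic Hilbert metric induced by $\mathcal{N}(X)$ satisfies $$d_{\mathcal{N}(X)}([p],[q])=\log\frac{\max\{M_{\log}(q/p),\,M_{\log}(\Delta_q/\Delta_p)\}}{\min\{m_{\log}(q/p),\,m_{\log}(\Delta_q/\Delta_p)\}}.$$
   Context: $\mathcal{N}(X)$ is the set of all norms on $X$ equivalent to the given norm of the Banach space $X$; $[p]$ is the class of $p$ modulo multiplication by positive scalars. The intrinsic order on $\mathcal{N}(X)$ is $u\preceq v$ iff $v-u\in\mathcal{N}(X)\cup\{0\}$. Norms $p,q\in\mathcal{N}(X)$ belong to the same intrinsic part if there exist $\alpha,\beta>0$ with $\alpha p\preceq q\preceq\beta p$. For such $p,q$ set $M_{\mathcal{N}(X)}(q/p)=\inf\{\lambda>0\mid\lambda p-q\in\mathcal{N}(X)\}$ and $m_{\mathcal{N}(X)}(q/p)=\sup\{\lambda>0\mid q-\lambda p\in\mathcal{N}(X)\}$; these equal the comparison constants $\inf\{\lambda>0\mid q\preceq\lambda p\}$ and $\sup\{\lambda>0\mid\lambda p\preceq q\}$. The intrinsic Hilbert metric is $d_{\mathcal{N}(X)}([p],[q])=\log\frac{M_{\mathcal{N}(X)}(q/p)}{m_{\mathcal{N}(X)}(q/p)}$. $M_{\log}(q/p)=\sup_{x\ne0}\frac{q(x)}{p(x)}$ and $m_{\log}(q/p)=\inf_{x\neq0}\frac{q(x)}{p(x)}$.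 The triangular defect is $\Delta_p(x,y)=p(x)+p(y)-p(x+y)$ for $x,y\in X$, and $M_{\log}(\Delta_q/\Delta_p)=\inf\{\lambda>0\mid\lambda\Delta_p(x,y)\ge\Delta_q(x,y)\ \forall x,y\in X\}$, $m_{\log}(\Delta_q/\Delta_p)=\sup\{\lambda>0\mid\Delta_q(x,y)\ge\lambda\Delta_p(x,y)\ \forall x,y\in X\}$. *)

theory Defs
  imports Complex_Main
begin

definition is_norm :: "('a::real_vector \<Rightarrow> real) \<Rightarrow> bool" where
  "is_norm p \<longleftrightarrow>
     (\<forall>x. p x \<ge> 0) \<and> (\<forall>x. p x = 0 \<longleftrightarrow> x = 0) \<and>
     (\<forall>c x. p (c *\<^sub>R x) = \<bar>c\<bar> * p x) \<and> (\<forall>x y. p (x + y) \<le> p x + p y)"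

definition equivalent_norms :: "('a \<Rightarrow> real) \<Rightarrow> ('a \<Rightarrow> real) \<Rightarrow> bool" where
  "equivalent_norms p q \<longleftrightarrow> (\<exists>a>0. \<exists>b>0. \<forall>x. a * p x \<le> q x \<and> q x \<le> b * p x)"

definition norms :: "('a::real_normed_vector \<Rightarrow> real) set" where
  "norms = {p. is_norm p \<and> equivalent_norms norm p}"

definition intrinsic_le :: "('a::real_normed_vector \<Rightarrow> real) \<Rightarrow> ('a \<Rightarrow> real) \<Rightarrow> bool"
    (infix "\<preceq>" 50) where
  "u \<preceq> v \<longleftrightarrow> (\<lambda>x. v x - u x) \<in> norms \<union> {\<lambda>x. 0}"

definition same_intrinsic_part :: "('a::real_normed_vector \<Rightarrow> real) \<Rightarrow> ('a \<Rightarrow> real) \<Rightarrow> bool" where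
  "same_intrinsic_part p q \<longleftrightarrow>
     (\<exists>\<alpha>>0. \<exists>\<beta>>0. (\<lambda>x. \<alpha> * p x) \<preceq> q \<and> q \<preceq> (\<lambda>x. \<beta> * p x))"

(* In all comparison constants below the argument order follows the fraction:
   the constant "of q/p" is written with q first. The infima and suprema are taken
   in the reals; for norms in the same intrinsic part of a nonzero space, the sets
   involved are nonempty and bounded on the relevant side. In particular the defect
   of p does not vanish identically, since it equals 2 * p x at (x, -x). *)

definition M_norms :: "('a::real_normed_vector \<Rightarrow> real) \<Rightarrow> ('a \<Rightarrow> real) \<Rightarrow> real" where
  "M_norms q p = Inf {l. l > 0 \<and> (\<lambda>x. l * p x - q x) \<in> norms}"

definition m_norms :: "('a::real_normed_vector \<Rightarrow> real) \<Rightarrow> ('a \<Rightarrow> real) \<Rightarrow> real" where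
  "m_norms q p = Sup {l. l > 0 \<and> (\<lambda>x. q x - l * p x) \<in> norms}"

definition ray :: "('a \<Rightarrow> real) \<Rightarrow> ('a \<Rightarrow> real) set" where
  "ray p = {(\<lambda>x. c * p x) | c. c > 0}"

(* The metric lives on classes: its value is the common value of the formula over all
   choices of representatives. Replacing p, q by c * p, d * q multiplies both constants
   by d / c, so for classes in the same intrinsic part the set below is a singleton. *)
definition intrinsic_hilbert_metric ::
    "('a::real_normed_vector \<Rightarrow> real) set \<Rightarrow> ('a \<Rightarrow> real) set \<Rightarrow> real" where
  "intrinsic_hilbert_metric P Q =
     the_elem (\<Union>p\<in>P. \<Union>q\<in>Q. {ln (M_norms q p / m_norms q p)})"

definition M_log :: "('a::zero \<Rightarrow> real) \<Rightarrow> ('a \<Rightarrow> real) \<Rightarrow> real" where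
  "M_log q p = (SUP x\<in>{x. x \<noteq> 0}. q x / p x)"

definition m_log :: "('a::zero \<Rightarrow> real) \<Rightarrow> ('a \<Rightarrow> real) \<Rightarrow> real" where
  "m_log q p = (INF x\<in>{x. x \<noteq> 0}. q x / p x)"

definition defect :: "('a::plus \<Rightarrow> real) \<Rightarrow> 'a \<Rightarrow> 'a \<Rightarrow> real" where
  "defect p x y = p x + p y - p (x + y)"

definition M_log_defect :: "('a::plus \<Rightarrow> real) \<Rightarrow> ('a \<Rightarrow> real) \<Rightarrow> real" where
  "M_log_defect q p = Inf {l. l > 0 \<and> (\<forall>x y. l * defect p x y \<ge> defect q x y)}"

definition m_log_defect :: "('a::plus \<Rightarrow> real) \<Rightarrow> ('a \<Rightarrow> real) \<Rightarrow> real" where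
  "m_log_defect q p = Sup {l. l > 0 \<and> (\<forall>x y. defect q x y \<ge> l * defect p x y)}"

end

(* A difference r = l p - q is absolutely homogeneous, and it satisfies the triangle inequality
   iff l * defect p >= defect q. Evaluating this inequality at (x, -x), where the defects are
   2 p x and 2 q x, already gives r >= 0. Hence the defect condition alone makes r a seminorm,
   and adding an arbitrarily small multiple of p makes it an equivalent norm: the constants of
   the intrinsic order coincide with the defect constants, and these dominate the pointwise ones. *)
theory Submission
  imports Defs
begin

section \<open>Absolute homogeneity and the triangular defect\<close>

definition abs_homogeneous :: "('a::real_vector \<Rightarrow> real) \<Rightarrow> bool" where
  "abs_homogeneous f \<longleftrightarrow> (\<forall>c x. f (c *\<^sub>R x) = \<bar>c\<bar> * f x)"

lemma abs_homogeneous_zero: "abs_homogeneous f \<Longrightarrow> f 0 = 0"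
  unfolding abs_homogeneous_def by (metis abs_zero mult_zero_left scaleR_zero_left)

lemma abs_homogeneous_minus: "abs_homogeneous f \<Longrightarrow> f (- x) = f x"
  unfolding abs_homogeneous_def by (metis abs_minus_cancel abs_one mult_1 scaleR_minus1_left)

text \<open>A difference of norms is homogeneous before anything is known about its sign or its
  triangle inequality, so homogeneity is kept apart from \<open>is_norm\<close>.\<close>

lemma abs_homogeneous_diff:
  "\<lbrakk>abs_homogeneous f; abs_homogeneous g\<rbrakk> \<Longrightarrow> abs_homogeneous (\<lambda>x. a * f x - b * g x)"
  by (simp add: abs_homogeneous_def algebra_simps)

lemma defect_minus: "abs_homogeneous f \<Longrightarrow> defect f x (- x) = 2 * f x"
  by (simp add: defect_def abs_homogeneous_zero abs_homogeneous_minus)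

lemma defect_scale: "defect (\<lambda>x. a * f x) x y = a * defect f x y"
  by (simp add: defect_def algebra_simps)

lemma defect_diff: "defect (\<lambda>x. a * f x - b * g x) x y = a * defect f x y - b * defect g x y"
  by (simp add: defect_def algebra_simps)

section \<open>The cone of equivalent norms\<close>

lemma normsD:
  assumes "p \<in> norms"
  shows "abs_homogeneous p" "0 \<le> p x" "x \<noteq> 0 \<Longrightarrow> 0 < p x" "0 \<le> defect p x y"
  using assms by (auto simp: norms_def is_norm_def abs_homogeneous_def defect_def less_le)

lemma norms_equivalent:
  assumes "p \<in> norms"
  obtains a b where "0 < a" "0 < b" "\<And>x. a * norm x \<le> p x" "\<And>x. p x \<le> b * norm x"
  using assms by (auto simp: norms_def equivalent_norms_def)

text \<open>The term \<open>e * p\<close> supplies definiteness and the lower norm bound;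
  \<open>k * g\<close> controls \<open>r\<close> from above. A second norm \<open>g\<close> is
  allowed because \<open>q - l * p\<close> is most easily bounded by \<open>q\<close>, while
  \<open>l * p - q\<close> is bounded by a multiple of \<open>p\<close>.\<close>

lemma norms_add_seminorm:
  assumes p: "p \<in> norms" and g: "g \<in> norms" and e: "0 < e" and k: "0 < k"
    and hom: "abs_homogeneous r" and def: "\<And>x y. 0 \<le> defect r x y"
    and upper: "\<And>x. r x \<le> k * g x"
  shows "(\<lambda>x. e * p x + r x) \<in> norms"
proof -
  obtain a b where ab: "0 < a" "0 < b" "\<And>x. a * norm x \<le> p x" "\<And>x. p x \<le> b * norm x"
    using norms_equivalent[OF p] by metis
  obtain a' b' where b': "0 < b'" "\<And>x. g x \<le> b' * norm x"
    using norms_equivalent[OF g] by metis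
  have r0: "0 \<le> r x" for x
    using def[of x "- x"] by (simp add: defect_minus[OF hom])
  have lower: "e * a * norm x \<le> e * p x + r x" for x
    using mult_left_mono[OF ab(3)[of x] less_imp_le[OF e]] r0[of x] by (simp only: mult.assoc)
  have up: "e * p x + r x \<le> (e * b + k * b') * norm x" for x
    using mult_left_mono[OF ab(4)[of x] less_imp_le[OF e]]
      mult_left_mono[OF b'(2)[of x] less_imp_le[OF k]] upper[of x]
    by (simp only: distrib_right mult.assoc)
  have "is_norm (\<lambda>x. e * p x + r x)"
    unfolding is_norm_def
  proof (intro conjI allI)
    fix x y c
    show "0 \<le> e * p x + r x"
      using e r0 normsD(2)[OF p] by simp
    show "e * p x + r x = 0 \<longleftrightarrow> x = 0"
    proof (cases "x = 0")
      case True
      then show ?thesis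
        by (simp add: abs_homogeneous_zero hom normsD(1)[OF p])
    next
      case False
      then have "0 < e * p x + r x"
        using e r0 normsD(3)[OF p] by (simp add: add_pos_nonneg)
      with False show ?thesis by simp
    qed
    show "e * p (c *\<^sub>R x) + r (c *\<^sub>R x) = \<bar>c\<bar> * (e * p x + r x)"
      using hom normsD(1)[OF p] by (simp add: abs_homogeneous_def algebra_simps)
    show "e * p (x + y) + r (x + y) \<le> e * p x + r x + (e * p y + r y)"
      using def[of x y] mult_nonneg_nonneg[OF less_imp_le[OF e] normsD(4)[OF p, of x y]]
      by (simp add: defect_def algebra_simps)
  qed
  moreover have "0 < e * a" "0 < e * b + k * b'"
    using e ab k b' by (simp_all add: add_pos_pos)
  ultimately show ?thesis
    using lower up unfolding norms_def equivalent_norms_def by blast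
qed

lemma norms_scale_iff:
  assumes "0 < c"
  shows "(\<lambda>x. c * f x) \<in> norms \<longleftrightarrow> f \<in> norms"
proof -
  have scale: "(\<lambda>x. c * f x) \<in> norms" if f: "f \<in> norms" and c: "0 < c" for c and f :: "'a \<Rightarrow> real"
  proof -
    \<comment> \<open>Scaling is the degenerate case in which the added seminorm is zero.\<close>
    have "abs_homogeneous (\<lambda>x. 0)" "\<And>x y. 0 \<le> defect (\<lambda>x. 0) x y" "\<And>x. 0 \<le> 1 * f x"
      using normsD(2)[OF f] by (simp_all add: abs_homogeneous_def defect_def)
    from norms_add_seminorm[OF f f c _ this] show ?thesis by simp
  qed
  have "(\<lambda>x. inverse c * (c * f x)) = f"
    using assms by (simp add: field_simps)
  then show ?thesis
    using scale[of f c] scale[of "\<lambda>x. c * f x" "inverse c"] assms by auto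
qed

section \<open>Intrinsic comparison constants as defect constants\<close>

lemma intrinsic_le_defect:
  assumes "u \<preceq> v"
  shows "defect u x y \<le> defect v x y"
proof -
  \<comment> \<open>The difference is either a norm, with nonnegative defect, or zero. The factors 1
    match the shape of \<open>defect_diff\<close>.\<close>
  have "0 \<le> defect (\<lambda>x. 1 * v x - 1 * u x) x y"
    using assms normsD(4)[of "\<lambda>x. v x - u x" x y] by (auto simp: intrinsic_le_def defect_def fun_eq_iff)
  then show ?thesis by (simp only: defect_diff)
qed

lemma defect_le_imp_le:
  assumes "abs_homogeneous f" "abs_homogeneous g" "\<forall>x y. a * defect f x y \<le> b * defect g x y"
  shows "a * f x \<le> b * g x"
  using assms(3)[rule_format, of x "- x"] by (simp add: defect_minus assms)

lemma diff_norms_imp_defect: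
  assumes "(\<lambda>x. a * f x - b * g x) \<in> norms"
  shows "\<forall>x y. b * defect g x y \<le> a * defect f x y"
  using normsD(4)[OF assms] by (simp add: defect_diff)

text \<open>The two admissible sets differ at most by their left endpoint: \<open>S\<close> lies in
  \<open>D\<close>, and \<open>D\<close> shifted up by any positive amount lies in \<open>S\<close>.
  The witness \<open>l\<^sub>0\<close> makes both nonempty, so that the real infima are
  meaningful.\<close>

lemma M_norms_eq_M_log_defect:
  assumes p: "p \<in> norms" and q: "q \<in> norms"
    and ne: "0 < l\<^sub>0" "\<forall>x y. l\<^sub>0 * defect p x y \<ge> defect q x y"
  shows "M_norms q p = M_log_defect q p"
proof -
  define S where "S = {l. l > 0 \<and> (\<lambda>x. l * p x - q x) \<in> norms}"
  define D where "D = {l. l > 0 \<and> (\<forall>x y. l * defect p x y \<ge> defect q x y)}"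
  have sub: "S \<subseteq> D"
    using diff_norms_imp_defect[of _ p 1 q] by (auto simp: S_def D_def)
  \<comment> \<open>For \<open>l\<close> in \<open>D\<close> the function \<open>l * p - q\<close>
    may vanish at nonzero vectors; adding \<open>e * p\<close> removes this degeneracy.\<close>
  have shift: "l + e \<in> S" if l: "l \<in> D" and e: "0 < e" for l e
  proof -
    have "abs_homogeneous (\<lambda>x. l * p x - 1 * q x)"
      by (intro abs_homogeneous_diff normsD(1) p q)
    moreover have "0 \<le> defect (\<lambda>x. l * p x - 1 * q x) x y" for x y
      unfolding defect_diff using l by (simp add: D_def)
    moreover have "l * p x - 1 * q x \<le> l * p x" for x
      using l normsD(2)[OF q, of x] by (simp add: D_def)
    ultimately have "(\<lambda>x. e * p x + (l * p x - 1 * q x)) \<in> norms"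
      using l by (intro norms_add_seminorm[OF p p e]) (auto simp: D_def)
    then show ?thesis
      using l e by (simp add: S_def D_def algebra_simps)
  qed
  have bdd: "bdd_below D"
    by (rule bdd_belowI[of _ 0]) (simp add: D_def)
  have l0: "l\<^sub>0 \<in> D" using ne by (simp add: D_def)
  have Sne: "S \<noteq> {}" using shift[OF l0, of 1] by auto
  have "Inf D \<le> Inf S"
    by (rule cInf_superset_mono[OF Sne bdd sub])
  moreover have "Inf S \<le> Inf D"
  proof (rule cInf_greatest)
    show "D \<noteq> {}" using l0 by blast
    fix l assume l: "l \<in> D"
    show "Inf S \<le> l"
      by (rule field_le_epsilon) (rule cInf_lower[OF shift[OF l] bdd_below_mono[OF bdd sub]])
  qed
  ultimately show ?thesis
    by (simp add: M_norms_def M_log_defect_def S_def D_def)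
qed

text \<open>A single nonzero vector bounds all admissible constants, through the pair (x, -x). In
  the zero space all defects vanish and every positive constant would be admissible.\<close>

lemma bdd_above_defect_constants:
  fixes p q :: "'a::real_normed_vector \<Rightarrow> real"
  assumes nontriv: "(UNIV :: 'a set) \<noteq> {0}" and p: "p \<in> norms" and q: "q \<in> norms"
  shows "bdd_above {l. l > 0 \<and> (\<forall>x y. defect q x y \<ge> l * defect p x y)}"
proof -
  obtain x :: 'a where x: "x \<noteq> 0" using nontriv by auto
  show ?thesis
  proof (rule bdd_aboveI)
    fix l assume "l \<in> {l. l > 0 \<and> (\<forall>x y. defect q x y \<ge> l * defect p x y)}"
    then have "l * p x \<le> 1 * q x"
      by (intro defect_le_imp_le normsD(1) p q) simp
    then show "l \<le> q x / p x"
      using normsD(3)[OF p x] by (simp add: field_simps)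
  qed
qed

lemma m_norms_eq_m_log_defect:
  fixes p q :: "'a::real_normed_vector \<Rightarrow> real"
  assumes nontriv: "(UNIV :: 'a set) \<noteq> {0}" and p: "p \<in> norms" and q: "q \<in> norms"
    and ne: "0 < l\<^sub>0" "\<forall>x y. defect q x y \<ge> l\<^sub>0 * defect p x y"
  shows "m_norms q p = m_log_defect q p"
proof -
  define S where "S = {l. l > 0 \<and> (\<lambda>x. q x - l * p x) \<in> norms}"
  define D where "D = {l. l > 0 \<and> (\<forall>x y. defect q x y \<ge> l * defect p x y)}"
  have sub: "S \<subseteq> D"
    using diff_norms_imp_defect[of 1 q _ p] by (auto simp: S_def D_def)
  \<comment> \<open>Lowering \<open>l\<close> adds \<open>e * p\<close> to the seminorm
    \<open>q - l * p\<close>; the condition \<open>e < l\<close> keeps the new constant positive, as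
    \<open>S\<close> requires.\<close>
  have shift: "l - e \<in> S" if l: "l \<in> D" and e: "0 < e" "e < l" for l e
  proof -
    have "abs_homogeneous (\<lambda>x. 1 * q x - l * p x)"
      by (intro abs_homogeneous_diff normsD(1) p q)
    moreover have "0 \<le> defect (\<lambda>x. 1 * q x - l * p x) x y" for x y
      unfolding defect_diff using l by (simp add: D_def)
    moreover have "1 * q x - l * p x \<le> 1 * q x" for x
      using l normsD(2)[OF p, of x] by (simp add: D_def)
    ultimately have "(\<lambda>x. e * p x + (1 * q x - l * p x)) \<in> norms"
      by (intro norms_add_seminorm[OF p q e(1) zero_less_one])
    then show ?thesis
      using e by (simp add: S_def algebra_simps)
  qed
  have bdd: "bdd_above D"
    unfolding D_def by (rule bdd_above_defect_constants[OF nontriv p q])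
  have l0: "l\<^sub>0 \<in> D" using ne by (simp add: D_def)
  have Sne: "S \<noteq> {}" using shift[OF l0, of "l\<^sub>0 / 2"] ne by auto
  have "Sup S \<le> Sup D"
    by (rule cSup_subset_mono[OF Sne bdd sub])
  moreover have "Sup D \<le> Sup S"
  proof (rule cSup_least)
    show "D \<noteq> {}" using l0 by blast
    fix l assume l: "l \<in> D"
    show "l \<le> Sup S"
    \<comment> \<open>Only \<open>w\<close> strictly between 0 and \<open>l\<close> need be tested,
      and each such \<open>w\<close> is the shift of \<open>l\<close> by
      \<open>l - w\<close>.\<close>
    proof (rule dense_le_bounded)
      show "0 < l" using l by (simp add: D_def)
      fix w assume "0 < w" "w < l"
      then have "w \<in> S" using shift[OF l, of "l - w"] by simp
      then show "w \<le> Sup S"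
        by (rule cSup_upper[OF _ bdd_above_mono[OF bdd sub]])
    qed
  qed
  ultimately show ?thesis
    by (simp add: m_norms_def m_log_defect_def S_def D_def)
qed

section \<open>Pointwise constants against defect constants\<close>

lemma M_log_le_M_log_defect:
  fixes p q :: "'a::real_normed_vector \<Rightarrow> real"
  assumes nontriv: "(UNIV :: 'a set) \<noteq> {0}" and p: "p \<in> norms" and q: "q \<in> norms"
    and ne: "0 < l\<^sub>0" "\<forall>x y. l\<^sub>0 * defect p x y \<ge> defect q x y"
  shows "M_log q p \<le> M_log_defect q p"
  unfolding M_log_def M_log_defect_def
\<comment> \<open>Every quotient lies below every admissible constant, so nonemptiness alone carries
  the inequality to the supremum and the infimum.\<close>
proof (intro cSUP_least cInf_greatest)
  show "{x::'a. x \<noteq> 0} \<noteq> {}" using nontriv by auto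
  show "{l. l > 0 \<and> (\<forall>x y. l * defect p x y \<ge> defect q x y)} \<noteq> {}" using ne by auto
  fix x :: 'a and l
  assume x: "x \<in> {x. x \<noteq> 0}" and l: "l \<in> {l. l > 0 \<and> (\<forall>x y. l * defect p x y \<ge> defect q x y)}"
  have "1 * q x \<le> l * p x"
    using l by (intro defect_le_imp_le normsD(1) p q) simp
  then show "q x / p x \<le> l"
    using normsD(3)[OF p] x by (simp add: field_simps)
qed

lemma m_log_defect_le_m_log:
  fixes p q :: "'a::real_normed_vector \<Rightarrow> real"
  assumes nontriv: "(UNIV :: 'a set) \<noteq> {0}" and p: "p \<in> norms" and q: "q \<in> norms"
    and ne: "0 < l\<^sub>0" "\<forall>x y. defect q x y \<ge> l\<^sub>0 * defect p x y"
  shows "m_log_defect q p \<le> m_log q p"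
  unfolding m_log_def m_log_defect_def
proof (intro cINF_greatest cSup_least)
  show "{x::'a. x \<noteq> 0} \<noteq> {}" using nontriv by auto
  show "{l. l > 0 \<and> (\<forall>x y. defect q x y \<ge> l * defect p x y)} \<noteq> {}" using ne by auto
  fix x :: 'a and l
  assume x: "x \<in> {x. x \<noteq> 0}" and l: "l \<in> {l. l > 0 \<and> (\<forall>x y. defect q x y \<ge> l * defect p x y)}"
  have "l * p x \<le> 1 * q x"
    using l by (intro defect_le_imp_le normsD(1) p q) simp
  then show "l \<le> q x / p x"
    using normsD(3)[OF p] x by (simp add: field_simps)
qed

section \<open>Change of representatives\<close>

lemma comparison_set_scale:
  fixes c d :: real
  assumes "0 < c" "0 < d"
    and "\<And>l. P' l \<longleftrightarrow> P (c / d * l)"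
  shows "{l. l > 0 \<and> P' l} = (\<lambda>l. d / c * l) ` {l. l > 0 \<and> P l}"
proof (intro set_eqI iffI)
  fix l assume "l \<in> {l. l > 0 \<and> P' l}"
  then show "l \<in> (\<lambda>l. d / c * l) ` {l. l > 0 \<and> P l}"
    using assms by (intro image_eqI[of _ _ "c / d * l"]) auto
next
  fix l assume "l \<in> (\<lambda>l. d / c * l) ` {l. l > 0 \<and> P l}"
  then obtain k where k: "l = d / c * k" "0 < k" "P k" by blast
  then have "c / d * l = k" using assms(1,2) by simp
  then show "l \<in> {l. l > 0 \<and> P' l}" using assms k by simp
qed

lemma M_log_defect_scale:
  assumes c: "0 < c" and d: "0 < d"
    and ne: "{l. l > 0 \<and> (\<forall>x y. l * defect p x y \<ge> defect q x y)} \<noteq> {}"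
  shows "M_log_defect (\<lambda>x. d * q x) (\<lambda>x. c * p x) = d / c * M_log_defect q p"
proof -
  have "(\<forall>x y. l * (c * defect p x y) \<ge> d * defect q x y) \<longleftrightarrow>
      (\<forall>x y. c / d * l * defect p x y \<ge> defect q x y)" for l
    using d by (simp add: field_simps)
  from comparison_set_scale[where P = "\<lambda>l. \<forall>x y. l * defect p x y \<ge> defect q x y", OF c d this]
  have "M_log_defect (\<lambda>x. d * q x) (\<lambda>x. c * p x)
      = Inf ((\<lambda>l. d / c * l) ` {l. l > 0 \<and> (\<forall>x y. l * defect p x y \<ge> defect q x y)})"
    by (simp add: M_log_defect_def defect_scale)
  \<comment> \<open>Multiplication by the positive factor \<open>d / c\<close> is monotone and
    continuous, hence commutes with the infimum of a nonempty set bounded below.\<close>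
  also have "\<dots> = d / c * M_log_defect q p"
    unfolding M_log_defect_def using c d ne
    by (intro continuous_at_Inf_mono[symmetric] monoI mult_left_mono continuous_intros bdd_belowI[of _ 0])
      auto
  finally show ?thesis .
qed

lemma m_log_defect_scale:
  assumes c: "0 < c" and d: "0 < d"
    and ne: "{l. l > 0 \<and> (\<forall>x y. defect q x y \<ge> l * defect p x y)} \<noteq> {}"
    and bdd: "bdd_above {l. l > 0 \<and> (\<forall>x y. defect q x y \<ge> l * defect p x y)}"
  shows "m_log_defect (\<lambda>x. d * q x) (\<lambda>x. c * p x) = d / c * m_log_defect q p"
proof -
  have "(\<forall>x y. d * defect q x y \<ge> l * (c * defect p x y)) \<longleftrightarrow>
      (\<forall>x y. defect q x y \<ge> c / d * l * defect p x y)" for l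
    using d by (simp add: field_simps)
  from comparison_set_scale[where P = "\<lambda>l. \<forall>x y. defect q x y \<ge> l * defect p x y", OF c d this]
  have "m_log_defect (\<lambda>x. d * q x) (\<lambda>x. c * p x)
      = Sup ((\<lambda>l. d / c * l) ` {l. l > 0 \<and> (\<forall>x y. defect q x y \<ge> l * defect p x y)})"
    by (simp add: m_log_defect_def defect_scale)
  also have "\<dots> = d / c * m_log_defect q p"
    unfolding m_log_defect_def using c d ne bdd
    by (intro continuous_at_Sup_mono[symmetric] monoI mult_left_mono continuous_intros) auto
  finally show ?thesis .
qed

section \<open>The Hilbert metric on rays\<close>

theorem theorem5p2:
  fixes p q :: "'a::banach \<Rightarrow> real"
  assumes "(UNIV :: 'a set) \<noteq> {0}"
    and "p \<in> norms" and "q \<in> norms"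
    and "same_intrinsic_part p q"
  shows "intrinsic_hilbert_metric (ray p) (ray q) =
    ln (max (M_log q p) (M_log_defect q p) / min (m_log q p) (m_log_defect q p))"
proof -
  note nontriv = assms(1) and p = assms(2) and q = assms(3)
  from assms(4) obtain \<alpha> \<beta> where \<alpha>: "0 < \<alpha>" "(\<lambda>x. \<alpha> * p x) \<preceq> q"
    and \<beta>: "0 < \<beta>" "q \<preceq> (\<lambda>x. \<beta> * p x)"
    unfolding same_intrinsic_part_def by blast
  have D\<alpha>: "\<forall>x y. defect q x y \<ge> \<alpha> * defect p x y"
    using intrinsic_le_defect[OF \<alpha>(2)] by (simp add: defect_scale)
  have D\<beta>: "\<forall>x y. \<beta> * defect p x y \<ge> defect q x y"
    using intrinsic_le_defect[OF \<beta>(2)] by (simp add: defect_scale)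
  let ?v = "ln (M_log_defect q p / m_log_defect q p)"
  \<comment> \<open>\<open>the_elem\<close> returns the intended value only on a singleton, so the
    formula must give the same number for all representatives.\<close>
  have const: "ln (M_norms q' p' / m_norms q' p') = ?v" if p': "p' \<in> ray p" and q': "q' \<in> ray q" for p' q'
  proof -
    from p' obtain c where c: "0 < c" and p'_eq: "p' = (\<lambda>x. c * p x)" by (auto simp: ray_def)
    from q' obtain d where d: "0 < d" and q'_eq: "q' = (\<lambda>x. d * q x)" by (auto simp: ray_def)
    have n: "p' \<in> norms" "q' \<in> norms"
      using p q c d by (simp_all add: p'_eq q'_eq norms_scale_iff)
    \<comment> \<open>The witnesses \<alpha> and \<beta>, rescaled by \<open>d / c\<close>, show
      that the comparison sets of the new representatives are nonempty.\<close>
    have "\<forall>x y. d * \<alpha> / c * defect p' x y \<le> defect q' x y" "\<forall>x y. d * \<beta> / c * defect p' x y \<ge> defect q' x y"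
      using D\<alpha> D\<beta> c d by (simp_all add: p'_eq q'_eq defect_scale)
    then have "M_norms q' p' = M_log_defect q' p'" "m_norms q' p' = m_log_defect q' p'"
      using c d \<alpha>(1) \<beta>(1)
      by (auto intro!: M_norms_eq_M_log_defect[OF n, of "d * \<beta> / c"]
          m_norms_eq_m_log_defect[OF nontriv n, of "d * \<alpha> / c"])
    moreover have "M_log_defect q' p' = d / c * M_log_defect q p"
      unfolding p'_eq q'_eq using D\<beta> \<beta>(1) by (intro M_log_defect_scale c d) auto
    moreover have "m_log_defect q' p' = d / c * m_log_defect q p"
      unfolding p'_eq q'_eq using D\<alpha> \<alpha>(1)
      by (intro m_log_defect_scale c d bdd_above_defect_constants nontriv p q) auto
    \<comment> \<open>The common factor \<open>d / c\<close> cancels in the quotient.\<close>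
    ultimately show ?thesis using c d by simp
  qed
  \<comment> \<open>A union of constant singletons collapses to that singleton only over nonempty
    index sets.\<close>
  have "p \<in> ray p" "q \<in> ray q"
    by (auto simp: ray_def intro!: exI[of _ "1::real"])
  then have ne: "ray p \<noteq> {}" "ray q \<noteq> {}" by blast+
  have "(\<Union>p'\<in>ray p. \<Union>q'\<in>ray q. {ln (M_norms q' p' / m_norms q' p')}) = (\<Union>p'\<in>ray p. \<Union>q'\<in>ray q. {?v})"
    by (intro SUP_cong refl) (simp add: const)
  also have "\<dots> = {?v}"
    using ne by simp
  finally have "(\<Union>p'\<in>ray p. \<Union>q'\<in>ray q. {ln (M_norms q' p' / m_norms q' p')}) = {?v}" .
  then have "intrinsic_hilbert_metric (ray p) (ray q) = ?v"
    by (simp add: intrinsic_hilbert_metric_def)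
  \<comment> \<open>The defect constants are the larger of the upper and the smaller of the lower
    constants, so they are the maximum and the minimum in the formula.\<close>
  then show ?thesis
    using M_log_le_M_log_defect[OF nontriv p q \<beta>(1) D\<beta>] m_log_defect_le_m_log[OF nontriv p q \<alpha>(1) D\<alpha>]
    by (simp add: max_absorb2 min_absorb2)
qed

end
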